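(* Let $(\mathcal{X},d)$ be a complete metric space, let $f\colon\mathcal{X}\to\mathbb{R}\cup\{+\infty\}$ be a closed function, and let $x\in\mathcal{X}$ be a point with $f(x)$ finite. Let $S\subseteq\mathcal{X}$ be an arbitrary set and let $x^*\in S$ be a point such that, for some constants $L>0$ and $\gamma>0$, the slope error-bound $$\operatorname{dist}(u;S)\leq L\cdot|\nabla f|(u)\quad\text{for all } u\in \mathbf{B}_\gamma(x^* )$$ holds. Let $f_x\colon\mathcal{X}\to\mathbb{R}\cup\{+\infty\}$ be a closed function such that for some $\eta>0$ $$|f_x(y)-f(y)|\leq\frac{\eta}{2}d^2(y,x)\quad\text{for all } y\in\mathcal{X}.$$ Then, letting $x^+$ be any minimizer of $f_x$, the following step-size error-bound holds: $$\operatorname{dist}(x;S)\leq(3L\eta+2)\cdot d(x^+,x)\quad\text{whenever } x,x^+\in\mathbf{B}_{\gamma/3}(x^* ).$$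
   Context: A function on a metric space is called closed if it is lower-semicontinuous. $\mathbf{B}_r(x)$ is the open ball of radius $r$ around $x$ and $\operatorname{dist}(x;S)=\inf_{y\in S}d(x,y)$. The slope of $f$ at a point $\bar x$ with $f(\bar x)$ finite is $|\nabla f|(\bar x):=\limsup_{x\to\bar x,\,x\ne\bar x}\frac{(f(\bar x)-f(x))^+}{d(\bar x,x)}$, where $r^+=\max\{0,r\}$ (it is $0$ if $\bar x$ is isolated); by convention $|\nabla f|(\bar x)=+\infty$ where $f(\bar x)=+\infty$. The inequality $|f_x(y)-f(y)|\le\frac{\eta}{2}d^2(y,x)$ is understood to mean that $f_x(y)$ and $f(y)$ are either both $+\infty$ or both finite and satisfying the inequality. *)

theory Defs
  imports "HOL-Analysis.Analysis"
begin

definition lower_semicontinuous :: "('a::topological_space \<Rightarrow> ereal) \<Rightarrow> bool" where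
  "lower_semicontinuous f \<longleftrightarrow> (\<forall>x. f x \<le> Liminf (at x) f)"

text \<open>
  The filter \<^term>\<open>at x\<close> is punctured at \<^term>\<open>x\<close>, and \<open>at x = bot\<close> means that \<^term>\<open>x\<close>
  is isolated; this case needs its own clause because \<open>Limsup bot\<close> is \<open>-\<infinity>\<close>, not \<open>0\<close>.
  The definition is intended for functions that never take the value \<open>-\<infinity>\<close>.
\<close>
definition slope :: "('a::metric_space \<Rightarrow> ereal) \<Rightarrow> 'a \<Rightarrow> ereal" where
  "slope f x =
    (if f x = \<infinity> then \<infinity>
     else if at x = bot then 0
     else Limsup (at x) (\<lambda>y. max 0 (f x - f y) / ereal (dist x y)))"

end

theory Submission
  imports Defs
begin

text \<open>
  Write \<open>r = d(x\<^sup>+, x)\<close> and \<open>g(y) = f(y) + (\<eta>/2) d\<^sup>2(y, x)\<close>. Since \<open>f\<^sub>x \<le> g\<close> and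
  \<open>g(x\<^sup>+) \<le> f\<^sub>x(x\<^sup>+) + \<eta> r\<^sup>2\<close>, the point \<open>x\<^sup>+\<close> minimizes \<open>g\<close> up to \<open>\<eta> r\<^sup>2\<close>. Ekeland's
  principle with constant \<open>\<eta> r\<close> yields \<open>z\<close> with \<open>d(z, x\<^sup>+) \<le> r\<close> where the slope of \<open>g\<close> is at
  most \<open>\<eta> r\<close>. As \<open>d(z, x) \<le> 2r\<close>, the quadratic term changes the slope by at most \<open>2 \<eta> r\<close>, so
  the slope of \<open>f\<close> at \<open>z\<close> is at most \<open>3 \<eta> r\<close>, and the slope error bound applies at \<open>z\<close>.
\<close>

text \<open>\<open>Liminf (at x)\<close> ignores \<open>x\<close> itself; the assumption
  \<open>a < f x\<close> fills in the centre, giving a full neighbourhood.\<close>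

lemma lower_semicontinuous_eventually:
  assumes "lower_semicontinuous f" "a < f x"
  shows "eventually (\<lambda>y. a < f y) (nhds x)"
proof -
  have "a < Liminf (at x) f"
    using assms by (auto simp: lower_semicontinuous_def intro: less_le_trans)
  from less_LiminfD[OF this] show ?thesis
    using assms(2) by (auto simp: eventually_at_filter elim!: eventually_mono)
qed

lemma lower_semicontinuous_closed_sublevel:
  assumes "lower_semicontinuous f"
  shows "closed {x. f x \<le> a}"
proof -
  have "open {x. a < f x}"
    using lower_semicontinuous_eventually[OF assms]
    by (subst open_subopen) (force simp: eventually_nhds)
  moreover have "{x. a < f x} = - {x. f x \<le> a}"
    by auto
  ultimately show ?thesis
    by (simp add: closed_def)
qed

lemma lower_semicontinuous_add_continuous:
  fixes f :: "'a::topological_space \<Rightarrow> ereal"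
  assumes f: "lower_semicontinuous f" and k: "continuous_on UNIV k"
  shows "lower_semicontinuous (\<lambda>x. f x + ereal (k x))"
  unfolding lower_semicontinuous_def le_Liminf_iff
proof (intro allI impI)
  fix x a
  assume a: "a < f x + ereal (k x)"
  then have "a - ereal (k x) < f x"
    by (cases a; cases "f x") auto
  \<comment> \<open>A real \<open>b\<close> in this gap decouples the summands: semicontinuity keeps
    \<open>f\<close> above \<open>b\<close>, and continuity keeps \<open>k\<close> above
    \<open>a - b\<close>.\<close>
  then obtain b where b: "a - ereal (k x) < ereal b" "ereal b < f x"
    using ereal_dense2 by blast
  have f_ev: "eventually (\<lambda>y. ereal b < f y) (at x)"
    using lower_semicontinuous_eventually[OF f b(2)] by (auto simp: eventually_at_filter elim: eventually_mono)
  have k_ev: "eventually (\<lambda>y. a < ereal b + ereal (k y)) (at x)"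
  proof (cases a)
    case (real r)
    have "(k \<longlongrightarrow> k x) (at x)"
      using k by (simp add: continuous_on_def)
    moreover have "r - b < k x"
      using b(1) real by simp
    ultimately have "eventually (\<lambda>y. r - b < k y) (at x)"
      by (rule order_tendstoD(1))
    then show ?thesis
      by eventually_elim (simp add: real)
  qed (use a in auto)
  from f_ev k_ev show "eventually (\<lambda>y. a < f y + ereal (k y)) (at x)"
  proof eventually_elim
    case (elim y)
    have "ereal b + ereal (k y) \<le> f y + ereal (k y)"
      using elim(1) by (intro add_right_mono) simp
    with elim(2) show ?case
      by (rule less_le_trans)
  qed
qed

text \<open>The relation \<open>w \<in> S y\<close> is a preorder whose lower sets
  \<open>S y\<close> are closed. A descending sequence of nearly minimal points makes these sets
  shrink to a single point \<open>z\<close> by completeness, and nothing other than \<open>z\<close>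
  lies below \<open>z\<close>; this is the strict inequality.\<close>

lemma ekeland_variational_principle:
  fixes f :: "'a::complete_space \<Rightarrow> ereal"
  assumes lsc: "lower_semicontinuous f" and bdd: "\<And>y. ereal m \<le> f y"
    and fin: "f x0 \<noteq> \<infinity>" and c: "c > 0"
  obtains z where "f z + ereal (c * dist z x0) \<le> f x0"
    and "\<And>y. y \<noteq> z \<Longrightarrow> f z < f y + ereal (c * dist y z)"
proof -
  define S where "S y = {w. f w + ereal (c * dist w y) \<le> f y}" for y
  have S_self: "y \<in> S y" for y
    by (simp add: S_def)
  have S_le: "f w \<le> f y" if "w \<in> S y" for w y
  proof -
    have "f w + 0 \<le> f w + ereal (c * dist w y)"
      using c by (intro add_left_mono) simp
    then show ?thesis
      using that by (simp add: S_def)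
  qed
  have S_trans: "S w \<subseteq> S y" if "w \<in> S y" for w y
  proof
    fix v assume "v \<in> S w"
    have "f v + ereal (c * dist v y) \<le> f v + ereal (c * dist v w + c * dist w y)"
      using c by (intro add_left_mono) (simp add: dist_triangle flip: distrib_left)
    also have "\<dots> = (f v + ereal (c * dist v w)) + ereal (c * dist w y)"
      by (simp add: add.assoc)
    also have "\<dots> \<le> f w + ereal (c * dist w y)"
      using \<open>v \<in> S w\<close> by (intro add_right_mono) (simp add: S_def)
    also have "\<dots> \<le> f y"
      using that by (simp add: S_def)
    finally show "v \<in> S y"
      by (simp add: S_def)
  qed
  have S_closed: "closed (S y)" for y
    unfolding S_def
    by (intro lower_semicontinuous_closed_sublevel lower_semicontinuous_add_continuous lsc
        continuous_intros)
  have near_min: "\<exists>w\<in>S y. \<forall>v\<in>S y. f w \<le> f v + ereal e"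
    if "f y \<noteq> \<infinity>" "e > 0" for y e
  proof -
    define I where "I = (INF v\<in>S y. f v)"
    have "I \<le> f y"
      unfolding I_def by (rule INF_lower[OF S_self])
    moreover have "ereal m \<le> I"
      unfolding I_def by (intro INF_greatest bdd)
    ultimately have "\<bar>I\<bar> \<noteq> \<infinity>"
      using that(1) by auto
    then have "I < I + ereal e"
      using that(2) by (cases I) auto
    then obtain w where w: "w \<in> S y" "f w < I + ereal e"
      unfolding I_def by (auto simp: INF_less_iff)
    have "f w \<le> f v + ereal e" if "v \<in> S y" for v
    proof -
      have "I + ereal e \<le> f v + ereal e"
        unfolding I_def using that by (intro add_right_mono INF_lower)
      with w(2) show ?thesis
        by simp
    qed
    with w(1) show ?thesis
      by blast
  qed
  \<comment> \<open>The invariant \<open>y n \<in> S x0\<close> keeps \<open>f (y n)\<close> finite,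
    as \<open>near_min\<close> requires. The factor \<open>c\<close> in the tolerance cancels later
    against the one in \<open>S\<close>.\<close>
  have "\<exists>y. \<forall>n. y n \<in> S x0 \<and> (y (Suc n) \<in> S (y n) \<and>
      (\<forall>v\<in>S (y n). f (y (Suc n)) \<le> f v + ereal (c * (1/2) ^ n)))"
  proof (rule dependent_nat_choice)
    show "\<exists>y. y \<in> S x0"
      using S_self by blast
    fix y and n :: nat
    assume y: "y \<in> S x0"
    then have "f y \<noteq> \<infinity>"
      using S_le fin by fastforce
    from near_min[OF this, of "c * (1/2) ^ n"] c obtain w
      where "w \<in> S y" "\<forall>v\<in>S y. f w \<le> f v + ereal (c * (1/2) ^ n)"
      by auto
    then show "\<exists>w. w \<in> S x0 \<and> (w \<in> S y \<and> (\<forall>v\<in>S y. f w \<le> f v + ereal (c * (1/2) ^ n)))"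
      using S_trans[OF y] by blast
  qed
  then obtain y where y: "\<And>n. y n \<in> S x0" "\<And>n. y (Suc n) \<in> S (y n)"
      "\<And>n v. v \<in> S (y n) \<Longrightarrow> f (y (Suc n)) \<le> f v + ereal (c * (1/2) ^ n)"
    by blast
  \<comment> \<open>Such a \<open>w\<close> also lies in \<open>S (y n)\<close>, over which
    \<open>y (Suc n)\<close> is nearly minimal. So \<open>f\<close> can drop from
    \<open>y (Suc n)\<close> to \<open>w\<close> by at most the tolerance, while membership forces a
    drop of at least \<open>c\<close> times the distance.\<close>
  have near: "dist w (y (Suc n)) \<le> (1/2) ^ n" if "w \<in> S (y (Suc n))" for w n
  proof -
    have "f w + ereal (c * dist w (y (Suc n))) \<le> f (y (Suc n))"
      using that by (simp add: S_def)
    also have "\<dots> \<le> f w + ereal (c * (1/2) ^ n)"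
      using that S_trans[OF y(2)] by (intro y(3)) blast
    finally have "f w + ereal (c * dist w (y (Suc n))) \<le> f w + ereal (c * (1/2) ^ n)" .
    moreover have "f w \<noteq> \<infinity>"
      using S_le[OF that] S_le[OF y(1)[of "Suc n"]] fin by auto
    moreover have "f w \<noteq> -\<infinity>"
      using bdd[of w] by auto
    ultimately have "c * dist w (y (Suc n)) \<le> c * (1/2) ^ n"
      by (cases "f w") auto
    with c show ?thesis
      by simp
  qed
  have "\<exists>z. \<Inter>(range (\<lambda>n. S (y n))) = {z}"
  proof (rule decreasing_closed_nest_sing)
    show "S (y n) \<subseteq> S (y m)" if "m \<le> n" for m n
      using lift_Suc_antimono_le[of "\<lambda>n. S (y n)"] S_trans[OF y(2)] that by blast
    fix e :: real assume "e > 0"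
    then obtain n where n: "(1/2) ^ n < e / 2"
      using real_arch_pow_inv[of "e / 2" "1/2"] by auto
    have "dist v w < e" if "v \<in> S (y (Suc n))" "w \<in> S (y (Suc n))" for v w
      using near[OF that(1)] near[OF that(2)] dist_triangle2[of v w "y (Suc n)"] n by linarith
    then show "\<exists>n. \<forall>v\<in>S (y n). \<forall>w\<in>S (y n). dist v w < e"
      by blast
  qed (use S_closed S_self in blast)+
  then obtain z where z: "\<Inter>(range (\<lambda>n. S (y n))) = {z}"
    by blast
  then have z_in: "z \<in> S (y n)" for n
    by blast
  show thesis
  proof
    show "f z + ereal (c * dist z x0) \<le> f x0"
      using S_trans[OF y(1)] z_in[of 0] by (auto simp: S_def)
    fix w assume "w \<noteq> z"
    \<comment> \<open>By transitivity a point below \<open>z\<close> lies in every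
      \<open>S (y n)\<close>, hence in their intersection \<open>{z}\<close>.\<close>
    have "w \<notin> S z"
    proof
      assume "w \<in> S z"
      then have "w \<in> \<Inter>(range (\<lambda>n. S (y n)))"
        using S_trans[OF z_in] by blast
      with z \<open>w \<noteq> z\<close> show False
        by simp
    qed
    then show "f z < f w + ereal (c * dist w z)"
      by (simp add: S_def not_le)
  qed
qed

text \<open>Division by \<open>dist z y\<close> bounds the difference quotient by
  \<open>max 0 (b y)\<close>, whose Limsup is its limit. Letting the coefficient vary with
  \<open>y\<close> accommodates a quadratic perturbation, of which only the limit \<open>B\<close>
  counts. \<open>B \<ge> 0\<close> covers isolated points, where the slope is 0.\<close>

lemma slope_le:
  assumes fin: "\<bar>f z\<bar> \<noteq> \<infinity>"
    and ev: "eventually (\<lambda>y. f z \<le> f y + ereal (b y * dist z y)) (at z)"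
    and b: "(b \<longlongrightarrow> B) (at z)" and B: "B \<ge> 0"
  shows "slope f z \<le> ereal B"
proof (cases "at z = bot")
  case True
  then show ?thesis
    using fin B by (auto simp: slope_def)
next
  case False
  have quotient_le: "eventually (\<lambda>y. max 0 (f z - f y) / ereal (dist z y) \<le> ereal (max 0 (b y))) (at z)"
    using ev eventually_neq_at_within[of z z]
  proof eventually_elim
    case (elim y)
    then have d: "dist z y > 0"
      by simp
    have "f z - f y \<le> ereal (b y * dist z y)"
      using elim(1) fin by (cases "f z"; cases "f y") auto
    also have "\<dots> \<le> ereal (max 0 (b y) * dist z y)"
      using d by simp
    finally have "max 0 (f z - f y) \<le> ereal (max 0 (b y) * dist z y)"
      using d by simp
    then show ?case
      using d by (simp add: ereal_divide_le_pos mult.commute del: ereal_max)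
  qed
  have "((\<lambda>y. ereal (max 0 (b y))) \<longlongrightarrow> ereal (max 0 B)) (at z)"
    using b by (intro tendsto_intros)
  then have "Limsup (at z) (\<lambda>y. ereal (max 0 (b y))) = ereal (max 0 B)"
    using False by (intro lim_imp_Limsup)
  with Limsup_mono[OF quotient_le] show ?thesis
    using False fin B by (auto simp: slope_def max_def)
qed

text \<open>This puts the change of the quadratic term into the form coefficient times distance that
  \<open>slope_le\<close> expects.\<close>

lemma dist_square_diff_le:
  fixes x y z :: "'a::metric_space"
  shows "(dist y x)\<^sup>2 - (dist z x)\<^sup>2 \<le> (dist y x + dist z x) * dist z y"
proof -
  have "(dist y x)\<^sup>2 - (dist z x)\<^sup>2 = (dist y x + dist z x) * (dist y x - dist z x)"
    by (simp add: power2_eq_square algebra_simps)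
  also have "\<dots> \<le> (dist y x + dist z x) * dist z y"
    using dist_triangle[of y x z] by (intro mult_left_mono) (auto simp: dist_commute)
  finally show ?thesis .
qed

theorem theorem3p5:
  fixes f fx :: "'a::complete_space \<Rightarrow> ereal"
    and S :: "'a set"
    and x xstar xplus :: 'a
    and L \<gamma> \<eta> :: real
  assumes f_proper: "\<forall>y. f y \<noteq> -\<infinity>"
    and f_closed: "lower_semicontinuous f"
    and f_finite_at_x: "\<bar>f x\<bar> \<noteq> \<infinity>"
    and xstar: "xstar \<in> S"
    and L: "L > 0"
    and gamma: "\<gamma> > 0"
    and slope_error_bound: "\<forall>u \<in> ball xstar \<gamma>. ereal (infdist u S) \<le> ereal L * slope f u"
    and model_proper: "\<forall>y. fx y \<noteq> -\<infinity>"
    and model_closed: "lower_semicontinuous fx"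
    and eta: "\<eta> > 0"
    and model_error: "\<forall>y. (fx y = \<infinity> \<and> f y = \<infinity>) \<or>
      (\<bar>fx y\<bar> \<noteq> \<infinity> \<and> \<bar>f y\<bar> \<noteq> \<infinity> \<and> \<bar>fx y - f y\<bar> \<le> ereal (\<eta> / 2 * (dist y x)\<^sup>2))"
    and minimizer: "\<forall>y. fx xplus \<le> fx y"
    and x_near: "x \<in> ball xstar (\<gamma> / 3)"
    and xplus_near: "xplus \<in> ball xstar (\<gamma> / 3)"
  shows "infdist x S \<le> (3 * L * \<eta> + 2) * dist xplus x"
proof -
  define r where "r = dist xplus x"
  define g where "g y = f y + ereal (\<eta> / 2 * (dist y x)\<^sup>2)" for y
  have fx_le_g: "fx y \<le> g y" for y
    using model_error[rule_format, of y]
    by (cases "fx y"; cases "f y") (auto simp: g_def abs_if split: if_splits)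
  have "fx x \<noteq> \<infinity>"
    using model_error[rule_format, of x] f_finite_at_x by auto
  with minimizer[rule_format, of x] have "fx xplus \<noteq> \<infinity>"
    by auto
  then obtain m p where m: "fx xplus = ereal m" and p: "f xplus = ereal p"
    and mp: "\<bar>m - p\<bar> \<le> \<eta> / 2 * r\<^sup>2"
    using model_error[rule_format, of xplus]
    by (cases "fx xplus"; cases "f xplus") (auto simp: r_def)
  have m_le_g: "ereal m \<le> g y" for y
    using minimizer[rule_format, of y] fx_le_g[of y] m by simp
  have g_xplus: "g xplus = ereal (p + \<eta> / 2 * r\<^sup>2)"
    by (simp add: g_def p r_def)
  have "lower_semicontinuous g"
    unfolding g_def
    by (intro lower_semicontinuous_add_continuous f_closed continuous_intros)
  have "\<exists>z. dist z xplus \<le> r \<and> g z \<noteq> \<infinity> \<and> (\<forall>y. g z \<le> g y + ereal (\<eta> * r * dist z y))"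
  proof (cases "r = 0")
    \<comment> \<open>Here the Ekeland constant \<open>\<eta> * r\<close> would vanish, but the
      model error at \<open>xplus\<close> is zero too, so \<open>xplus\<close> minimizes
      \<open>g\<close> exactly.\<close>
    case True
    then have "g xplus \<le> g y" for y
      using m_le_g[of y] g_xplus mp by simp
    with True show ?thesis
      by (intro exI[of _ xplus]) (simp add: g_xplus)
  next
    case False
    then have c: "\<eta> * r > 0" and r: "r > 0"
      using eta by (auto simp: r_def)
    obtain z where z: "g z + ereal (\<eta> * r * dist z xplus) \<le> g xplus"
        "\<And>y. y \<noteq> z \<Longrightarrow> g z < g y + ereal (\<eta> * r * dist y z)"
      using ekeland_variational_principle[OF \<open>lower_semicontinuous g\<close> m_le_g _ c, of xplus]
      by (auto simp: g_xplus)
    obtain q where q: "g z = ereal q"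
      using z(1) m_le_g[of z] by (cases "g z") (auto simp: g_xplus)
    \<comment> \<open>The bound is the sum of two equal halves: the quadratic term in
      \<open>g xplus\<close> and the model error between \<open>m\<close> and
      \<open>p\<close>.\<close>
    have "\<eta> * r * dist z xplus \<le> \<eta> * r\<^sup>2"
      using z(1) m_le_g[of z] mp by (simp add: q g_xplus abs_if split: if_splits)
    then have "\<eta> * r * dist z xplus \<le> \<eta> * r * r"
      by (simp only: power2_eq_square mult.assoc)
    then have "dist z xplus \<le> r"
      using c by (simp only: mult_le_cancel_left_pos)
    moreover have "g z \<le> g y + ereal (\<eta> * r * dist z y)" for y
      using z(2)[of y] by (cases "y = z") (auto simp: dist_commute)
    ultimately show ?thesis
      by (intro exI[of _ z]) (simp add: q)
  qed
  then obtain z where z_xplus: "dist z xplus \<le> r" and z_fin: "g z \<noteq> \<infinity>"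
    and z_min: "\<And>y. g z \<le> g y + ereal (\<eta> * r * dist z y)"
    by blast
  have z_x: "dist z x \<le> 2 * r"
    using dist_triangle[of z x xplus] z_xplus by (simp add: r_def)
  have fz: "\<bar>f z\<bar> \<noteq> \<infinity>"
    using z_fin f_proper by (auto simp: g_def)
  have "slope f z \<le> ereal (\<eta> * r + \<eta> / 2 * (dist z x + dist z x))"
  proof (rule slope_le)
    show "\<bar>f z\<bar> \<noteq> \<infinity>"
      by (fact fz)
    \<comment> \<open>The summand \<open>\<eta> * r\<close> comes from Ekeland's principle, the
      other from the difference of the quadratic terms of \<open>g\<close> at \<open>y\<close> and
      \<open>z\<close>; as \<open>y\<close> tends to \<open>z\<close> the latter tends to
      \<open>\<eta> * dist z x\<close>, at most \<open>2 * \<eta> * r\<close>.\<close>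
    show "eventually (\<lambda>y. f z \<le> f y + ereal ((\<eta> * r + \<eta> / 2 * (dist y x + dist z x)) * dist z y)) (at z)"
    proof (intro always_eventually allI)
      fix y
      have "\<eta> / 2 * ((dist y x)\<^sup>2 - (dist z x)\<^sup>2) \<le> \<eta> / 2 * ((dist y x + dist z x) * dist z y)"
        using eta by (intro mult_left_mono dist_square_diff_le) simp
      then show "f z \<le> f y + ereal ((\<eta> * r + \<eta> / 2 * (dist y x + dist z x)) * dist z y)"
        using z_min[of y] fz f_proper
        by (cases "f z"; cases "f y") (auto simp: g_def algebra_simps)
    qed
    show "((\<lambda>y. \<eta> * r + \<eta> / 2 * (dist y x + dist z x))
        \<longlongrightarrow> \<eta> * r + \<eta> / 2 * (dist z x + dist z x)) (at z)"
      by (intro tendsto_intros)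
    show "0 \<le> \<eta> * r + \<eta> / 2 * (dist z x + dist z x)"
      using eta by (simp add: r_def)
  qed
  also have "\<dots> \<le> ereal (3 * \<eta> * r)"
    using mult_left_mono[OF z_x, of \<eta>] eta by (simp add: algebra_simps)
  finally have slope_z: "slope f z \<le> ereal (3 * \<eta> * r)" .
  \<comment> \<open>Both points lie within \<open>\<gamma> / 3\<close> of \<open>xstar\<close>, so
    \<open>r < 2 * \<gamma> / 3\<close>; going from \<open>xstar\<close> to \<open>z\<close> through
    \<open>xplus\<close> costs less than \<open>\<gamma> / 3 + r\<close>.\<close>
  have "dist xstar z < \<gamma>"
    using dist_triangle[of xstar z xplus] dist_triangle[of xplus x xstar] z_xplus x_near xplus_near
    by (simp add: r_def dist_commute)
  then have "ereal (infdist z S) \<le> ereal L * slope f z"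
    using slope_error_bound by simp
  also have "\<dots> \<le> ereal L * ereal (3 * \<eta> * r)"
    using slope_z L by (intro ereal_mult_left_mono) auto
  finally have "infdist z S \<le> L * (3 * \<eta> * r)"
    by simp
  \<comment> \<open>The distance to \<open>S\<close> is 1-Lipschitz, so moving from \<open>z\<close>
    to \<open>x\<close> adds at most \<open>2 * r\<close>.\<close>
  then have "infdist x S \<le> L * (3 * \<eta> * r) + 2 * r"
    using infdist_triangle[of x S z] z_x by (simp add: dist_commute)
  then show ?thesis
    by (simp add: r_def algebra_simps)
qed

end
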